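(* Let $p\equiv 1\pmod 6$ be a prime and $a\in\mathbb{F}_p^*$. Let $N_{p,a}$ be the number of $\mathbb{F}_p$-rational points (including the point at infinity) of the elliptic curve $y^{2}=x^{3}+a^{3}$ over $\mathbb{F}_p$. Then $a\in Q_p$ if and only if $N_{p,a}\equiv 0\pmod 6$.
   Context: $Q_p$ denotes the set of quadratic residues modulo $p$, i.e. the nonzero squares in $\mathbb{F}_p$. *)

theory Defs
  imports "HOL-Number_Theory.Number_Theory"
begin

definition quadratic_residues :: "nat \<Rightarrow> int set" where
  "quadratic_residues p =
     {a \<in> carrier (residue_ring (int p)) - {\<zero>\<^bsub>residue_ring (int p)\<^esub>}.
        \<exists>b \<in> carrier (residue_ring (int p)). a = b [^]\<^bsub>residue_ring (int p)\<^esub> (2::nat)}"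

datatype 'a curve_point = Infinity | Affine 'a 'a

text \<open>
  The \<open>K\<close>-rational points of the projective closure of \<open>y\<^sup>2 = x\<^sup>3 + A x + B\<close>;
  this closure has exactly one point at infinity, namely \<open>(0 : 1 : 0)\<close>.
\<close>
definition weierstrass_points ::
    "('a, 'b) ring_scheme \<Rightarrow> 'a \<Rightarrow> 'a \<Rightarrow> 'a curve_point set" where
  "weierstrass_points K A B = insert Infinity
     {Affine x y | x y. x \<in> carrier K \<and> y \<in> carrier K \<and>
        y [^]\<^bsub>K\<^esub> (2::nat) = x [^]\<^bsub>K\<^esub> (3::nat) \<oplus>\<^bsub>K\<^esub> A \<otimes>\<^bsub>K\<^esub> x \<oplus>\<^bsub>K\<^esub> B}"

definition num_points_cubed :: "nat \<Rightarrow> int \<Rightarrow> nat" where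
  "num_points_cubed p a =
     card (weierstrass_points (residue_ring (int p)) \<zero>\<^bsub>residue_ring (int p)\<^esub>
             (a [^]\<^bsub>residue_ring (int p)\<^esub> (3::nat)))"

text \<open>
  Two sanity checks: the point set is finite, so that \<open>card\<close> really counts, and the
  curve is nonsingular, so that it is an elliptic curve.
\<close>

lemma finite_weierstrass_points:
  assumes "finite (carrier K)"
  shows "finite (weierstrass_points K A B)"
proof -
  have "weierstrass_points K A B \<subseteq>
          insert Infinity ((\<lambda>(x, y). Affine x y) ` (carrier K \<times> carrier K))"
    by (auto simp: weierstrass_points_def)
  then show ?thesis
    using assms by (meson finite.insertI finite_SigmaI finite_imageI finite_subset)
qed

context residues
begin

lemma nat_pow_eq:
  assumes "x \<in> carrier R"
  shows "x [^] (n::nat) = x ^ n mod m"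
proof -
  have "x mod m = x"
    using assms by (simp add: res_carrier_eq)
  then show ?thesis
    using pow_cong[of x n] by simp
qed

lemma add_pow_eq: "[n] \<cdot> x = (int n * x) mod m"
proof (induct n)
  case 0
  then show ?case
    by (simp add: add_pow_def res_zero_eq)
next
  case (Suc n)
  have "[Suc n] \<cdot> x = [n] \<cdot> x \<oplus> x"
    by (simp add: add_pow_def)
  then show ?case
    using Suc by (simp add: res_add_eq mod_simps algebra_simps)
qed

end

lemma discriminant_nonzero:
  fixes p :: nat and a :: int
  defines "K \<equiv> residue_ring (int p)"
  assumes "prime p" and "[p = 1] (mod 6)" and "a \<in> carrier K - {\<zero>\<^bsub>K\<^esub>}"
  shows "[(4::nat)] \<cdot>\<^bsub>K\<^esub> (\<zero>\<^bsub>K\<^esub> [^]\<^bsub>K\<^esub> (3::nat)) \<oplus>\<^bsub>K\<^esub>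
         [(27::nat)] \<cdot>\<^bsub>K\<^esub> ((a [^]\<^bsub>K\<^esub> (3::nat)) [^]\<^bsub>K\<^esub> (2::nat)) \<noteq> \<zero>\<^bsub>K\<^esub>"
proof
  interpret residues_prime p K
    by unfold_locales (simp_all add: assms)
  assume "[(4::nat)] \<cdot>\<^bsub>K\<^esub> (\<zero>\<^bsub>K\<^esub> [^]\<^bsub>K\<^esub> (3::nat)) \<oplus>\<^bsub>K\<^esub>
          [(27::nat)] \<cdot>\<^bsub>K\<^esub> ((a [^]\<^bsub>K\<^esub> (3::nat)) [^]\<^bsub>K\<^esub> (2::nat)) = \<zero>\<^bsub>K\<^esub>"
  moreover have a: "a \<in> carrier K" "0 < a" "a < int p"
    using assms(4) by (auto simp: res_carrier_eq res_zero_eq)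
  ultimately have "(27 * (a ^ 3) ^ 2) mod int p = 0"
    by (simp add: nat_pow_eq add_pow_eq res_add_eq res_zero_eq res_carrier_eq mod_simps)
  then have "int p dvd 3 ^ 3 * (a ^ 3) ^ 2"
    by (simp add: dvd_eq_mod_eq_0)
  moreover have "prime (int p)"
    using assms(2) by simp
  ultimately have "int p dvd 3 \<or> int p dvd a"
    by (meson prime_dvd_mult_iff prime_dvd_power)
  moreover have "\<not> int p dvd a"
    using a by (simp add: zdvd_not_zless)
  ultimately have "p dvd 3"
    by (metis int_dvd_int_iff of_nat_numeral)
  then have "p \<le> 3"
    by (auto dest: dvd_imp_le)
  moreover have "p > 1"
    using assms(2) prime_gt_1_nat by blast
  ultimately show False
    using assms(3) by (auto simp: cong_def)
qed

end

theory Submission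
  imports Defs
begin

text \<open>
  Let \<open>w\<close> be a primitive cube root of unity modulo \<open>p\<close>. The map \<open>(x, y) \<mapsto> (x, - y)\<close> is an
  involution of the affine points whose fixed points are the three points \<open>(- a w\<^sup>i, 0)\<close>, so
  \<open>N\<close> is always even. The map \<open>(x, y) \<mapsto> (w x, y)\<close> has order 3 and its fixed points are the
  points \<open>(0, y)\<close> with \<open>y\<^sup>2 = a\<^sup>3\<close>; there are two of them if \<open>a\<close> is a square and none otherwise.
  Hence \<open>N\<close> is 0 or 1 modulo 3 accordingly.
\<close>

section \<open>Fixed points of maps of prime period\<close>

lemma funpow_inverse_of_period:
  assumes "(f ^^ q) x = x" "q > 0"
  shows "(f ^^ (i * (q - 1))) ((f ^^ i) x) = x"
proof -
  have "i * (q - 1) + i = i * q"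
    using assms(2) by (cases q) auto
  then have "(f ^^ (i * (q - 1))) ((f ^^ i) x) = (f ^^ (i * q)) x"
    by (metis comp_apply funpow_add)
  also have "\<dots> = (f ^^ (i * q mod q)) x"
    by (rule funpow_mod_eq[OF assms(1), symmetric])
  finally show ?thesis by simp
qed

text \<open>Bezout gives \<open>i * u = q * v + 1\<close>. Both \<open>i * u\<close> and
  \<open>q * v\<close> steps lead from \<open>x\<close> back to \<open>x\<close>, so the single step
  between them fixes \<open>x\<close>.\<close>

lemma funpow_fixpoint_coprime:
  assumes "(f ^^ i) x = x" "(f ^^ q) x = x" "coprime i q" "i > 0"
  shows "f x = x"
proof -
  obtain u v where "i * u = q * v + 1"
    using bezout_nat[of i q] assms(3,4) by auto
  then have "f ((f ^^ (q * v)) x) = (f ^^ (i * u)) x"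
    by simp
  moreover have "(f ^^ (i * u)) x = x" "(f ^^ (q * v)) x = x"
    using funpow_mod_eq[OF assms(1), of "i * u"] funpow_mod_eq[OF assms(2), of "q * v"]
    by simp_all
  ultimately show ?thesis by simp
qed

text \<open>The orbits of \<open>f\<close> partition \<open>S\<close>, and primality of
  \<open>q\<close> together with the absence of fixed points forces every orbit to have exactly
  \<open>q\<close> elements.\<close>

lemma prime_dvd_card_of_free_funpow:
  assumes "prime q" "finite S" "f ` S \<subseteq> S"
    and period: "\<And>x. x \<in> S \<Longrightarrow> (f ^^ q) x = x"
    and free: "\<And>x. x \<in> S \<Longrightarrow> f x \<noteq> x"
  shows "q dvd card S"
proof -
  have q: "q > 0"
    using assms(1) by (rule prime_gt_0_nat)
  define orb where "orb x = range (\<lambda>i. (f ^^ i) x)" for x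
  have closed: "(f ^^ i) x \<in> S" if "x \<in> S" for i x
    using assms(3) that by (induction i) auto
  have sub: "orb ((f ^^ i) x) \<subseteq> orb x" for i x
    unfolding orb_def by (auto simp: funpow_add[symmetric, unfolded o_def fun_eq_iff])
  have orb_eq: "orb ((f ^^ i) x) = orb x" if "x \<in> S" for i x
  proof
    \<comment> \<open>The orbit of the iterate contains \<open>x\<close> again: another
      \<open>i * (q - 1)\<close> steps complete \<open>i\<close> full periods.\<close>
    show "orb x \<subseteq> orb ((f ^^ i) x)"
      using sub[of "i * (q - 1)" "(f ^^ i) x"] funpow_inverse_of_period[OF period[OF that] q]
      by simp
  qed (rule sub)
  have "card (orb x) = q" if x: "x \<in> S" for x
  proof -
    have "orb x = (\<lambda>i. (f ^^ i) x) ` {..<q}"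
    proof (intro equalityI subsetI)
      fix z assume "z \<in> orb x"
      then obtain i where "z = (f ^^ (i mod q)) x"
        by (auto simp: orb_def funpow_mod_eq[OF period[OF x]])
      then show "z \<in> (\<lambda>i. (f ^^ i) x) ` {..<q}"
        using q by auto
    qed (auto simp: orb_def)
    moreover have "inj_on (\<lambda>i. (f ^^ i) x) {..<q}"
    proof (rule linorder_inj_onI')
      fix i j assume ij: "i \<in> {..<q}" "j \<in> {..<q}" "i < j"
      show "(f ^^ i) x \<noteq> (f ^^ j) x"
      proof
        \<comment> \<open>A coincidence makes \<open>j - i\<close> a period of
          \<open>(f ^^ i) x\<close>. It lies strictly between 0 and the prime \<open>q\<close>, so
          it is coprime to \<open>q\<close>, and the point would be fixed by
          \<open>f\<close>.\<close>
        assume "(f ^^ i) x = (f ^^ j) x"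
        also have "(f ^^ j) x = (f ^^ (j - i)) ((f ^^ i) x)"
          using ij(3) by (metis comp_apply funpow_add le_add_diff_inverse2 less_imp_le)
        finally have "(f ^^ (j - i)) ((f ^^ i) x) = (f ^^ i) x" by simp
        moreover have "coprime (j - i) q"
          using ij assms(1)
          by (metis coprime_commute lessThan_iff less_imp_diff_less nat_dvd_not_less
              prime_imp_coprime zero_less_diff)
        ultimately have "f ((f ^^ i) x) = (f ^^ i) x"
          using funpow_fixpoint_coprime period closed[OF x] ij(3) zero_less_diff by metis
        then show False
          using free closed[OF x] by blast
      qed
    qed
    ultimately show ?thesis
      by (simp add: card_image)
  qed
  moreover have "\<forall>A\<in>orb ` S. \<forall>B\<in>orb ` S. A \<noteq> B \<longrightarrow> A \<inter> B = {}"
  proof (intro ballI impI)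
    fix A B assume "A \<in> orb ` S" "B \<in> orb ` S" and ne: "A \<noteq> B"
    then obtain x y where xy: "x \<in> S" "y \<in> S" "A = orb x" "B = orb y" by auto
    show "A \<inter> B = {}"
    proof (rule ccontr)
      assume "A \<inter> B \<noteq> {}"
      then obtain i j where "(f ^^ i) x = (f ^^ j) y"
        unfolding xy orb_def by auto
      then show False
        using orb_eq xy ne by metis
    qed
  qed
  moreover have S: "\<Union> (orb ` S) = S"
  proof
    show "S \<subseteq> \<Union> (orb ` S)"
      unfolding orb_def by (force intro: range_eqI[of _ _ 0])
    show "\<Union> (orb ` S) \<subseteq> S"
      unfolding orb_def using closed by auto
  qed
  ultimately have "q dvd card (\<Union> (orb ` S))"
    using assms(2) by (intro dvd_partition) auto
  then show ?thesis
    using S by simp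
qed

text \<open>Off its fixed points \<open>f\<close> acts freely with period \<open>q\<close>, so the
  points that move contribute a multiple of \<open>q\<close>.\<close>

lemma card_cong_card_fixpoints:
  assumes "prime q" "finite S" "f ` S \<subseteq> S"
    and period: "\<And>x. x \<in> S \<Longrightarrow> (f ^^ q) x = x"
  shows "[card S = card {x \<in> S. f x = x}] (mod q)"
proof -
  let ?F = "{x \<in> S. f x = x}"
  have "f ` (S - ?F) \<subseteq> S - ?F"
  proof (rule image_subsetI)
    fix x assume "x \<in> S - ?F"
    then have x: "x \<in> S" "x \<notin> ?F" by auto
    have "f x \<in> S" using assms(3) x by auto
    \<comment> \<open>A moved point cannot land on a fixed point: all its later iterates would equal
      \<open>f x\<close>, whereas the \<open>q\<close>-th one is \<open>x\<close>.\<close>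
    moreover have "f x = x" if "f (f x) = f x"
    proof -
      have "(f ^^ Suc n) x = f x" for n
        using that by (induction n) auto
      then show ?thesis
        using period[OF x(1)] assms(1)
        by (metis Suc_pred prime_gt_0_nat)
    qed
    ultimately show "f x \<in> S - ?F"
      using x by auto
  qed
  then have "q dvd card (S - ?F)"
    using assms by (intro prime_dvd_card_of_free_funpow[of q _ f]) auto
  moreover have "card S = card (S - ?F) + card ?F"
    using card_Int_Diff[OF assms(2), of ?F] by (simp add: Int_absorb1)
  ultimately show ?thesis
    by (auto simp: cong_def elim!: dvdE)
qed

section \<open>Prime moduli and cube roots of unity\<close>

lemma cong_mult_rcancel_prime:
  fixes p x y c :: int
  assumes "prime p" "\<not> p dvd c"
  shows "[x * c = y * c] (mod p) \<longleftrightarrow> [x = y] (mod p)"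
  using assms by (intro cong_mult_rcancel) (metis coprime_commute prime_imp_coprime)

lemma cong_square_iff_prime:
  fixes p x y :: int
  assumes "prime p"
  shows "[x\<^sup>2 = y\<^sup>2] (mod p) \<longleftrightarrow> [x = y] (mod p) \<or> [x = - y] (mod p)"
proof -
  have "x\<^sup>2 - y\<^sup>2 = (x - y) * (x + y)"
    by (simp add: power2_eq_square algebra_simps)
  then show ?thesis
    using assms by (simp add: cong_iff_dvd_diff prime_dvd_mult_iff)
qed

text \<open>The unit group modulo \<open>p\<close> is cyclic of order \<open>p - 1\<close>, a
  multiple of 3, so a generator raised to the power \<open>(p - 1) / 3\<close> has order exactly 3.
  The quadratic relation is the cofactor of \<open>w - 1\<close> in
  \<open>w ^ 3 - 1\<close>.\<close>

lemma primitive_cube_root_of_unity: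
  fixes p :: nat
  assumes "prime p" "[p = 1] (mod 3)"
  obtains w :: int where "[w ^ 3 = 1] (mod p)" "\<not> [w = 1] (mod p)"
    "[w\<^sup>2 + w + 1 = 0] (mod p)"
proof -
  obtain g where g: "residue_primroot p g"
    using assms(1) prime_primitive_root_exists prime_gt_1_nat by blast
  then have ordg: "ord p g = p - 1"
    using assms(1) by (simp add: residue_primroot_def totient_prime)
  obtain k where k: "p - 1 = 3 * k" "k > 0"
  proof -
    have "p > 1" using assms(1) by (rule prime_gt_1_nat)
    then have "3 dvd p - 1"
      using assms(2) by (simp add: cong_altdef_nat cong_sym_eq)
    then show ?thesis
      using that \<open>p > 1\<close> by (metis dvdE mult_0_right not_gr0 zero_less_diff)
  qed
  define w where "w = int g ^ k"
  have "[g ^ (3 * k) = 1] (mod p)"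
    using ord[of g p] ordg k by simp
  then have 1: "[w ^ 3 = 1] (mod p)"
    unfolding w_def by (metis cong_int_iff mult.commute of_nat_1 of_nat_power power_mult)
  have "\<not> [g ^ k = 1] (mod p)"
    using ord_divides[of g k p] ordg k by (auto dest: dvd_imp_le)
  then have 2: "\<not> [w = 1] (mod p)"
    unfolding w_def by (metis cong_int_iff of_nat_1 of_nat_power)
  have "w ^ 3 - 1 = (w - 1) * (w\<^sup>2 + w + 1)"
    by (simp add: power2_eq_square power3_eq_cube algebra_simps)
  then have "[w\<^sup>2 + w + 1 = 0] (mod p)"
    using 1 2 assms(1) by (simp add: cong_iff_dvd_diff prime_dvd_mult_iff)
  with 1 2 show ?thesis by (rule that)
qed

section \<open>From the residue ring to integer congruences\<close>

definition affine_points :: "int \<Rightarrow> int \<Rightarrow> (int \<times> int) set" where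
  "affine_points p c = {(x, y). x \<in> {0..<p} \<and> y \<in> {0..<p} \<and> [y\<^sup>2 = x ^ 3 + c] (mod p)}"

lemma finite_affine_points: "finite (affine_points p c)"
  by (rule finite_subset[of _ "{0..<p} \<times> {0..<p}"]) (auto simp: affine_points_def)

text \<open>\<open>Suc\<close> accounts for the point at infinity. Ring elements are the integers in
  \<open>{0..<p}\<close>, so the curve equation, whose linear term vanishes, becomes a
  congruence.\<close>

lemma num_points_cubed_eq:
  assumes "prime p" "a \<in> carrier (residue_ring (int p))"
  shows "num_points_cubed p a = Suc (card (affine_points p (a ^ 3)))"
proof -
  define K where "K = residue_ring (int p)"
  interpret residues_prime p K
    by unfold_locales (simp_all add: assms K_def)
  have carr: "carrier K = {0..<int p}"
    by (auto simp: res_carrier_eq)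
  have eq: "y [^]\<^bsub>K\<^esub> (2::nat) = x [^]\<^bsub>K\<^esub> (3::nat) \<oplus>\<^bsub>K\<^esub> \<zero>\<^bsub>K\<^esub> \<otimes>\<^bsub>K\<^esub> x \<oplus>\<^bsub>K\<^esub> a [^]\<^bsub>K\<^esub> (3::nat)
      \<longleftrightarrow> [y\<^sup>2 = x ^ 3 + a ^ 3] (mod p)" if "x \<in> carrier K" "y \<in> carrier K" for x y
    using that assms(2)[folded K_def]
    by (simp add: nat_pow_eq res_add_eq res_mult_eq res_zero_eq cong_def mod_simps)
  have "weierstrass_points K \<zero>\<^bsub>K\<^esub> (a [^]\<^bsub>K\<^esub> (3::nat)) =
      insert Infinity ((\<lambda>(x, y). Affine x y) ` affine_points p (a ^ 3))"
    unfolding weierstrass_points_def affine_points_def using eq carr by auto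
  moreover have "inj_on (\<lambda>(x, y). Affine x y) (affine_points p (a ^ 3))"
    by (auto simp: inj_on_def)
  ultimately show ?thesis
    unfolding num_points_cubed_def K_def[symmetric]
    by (subst \<open>weierstrass_points _ _ _ = _\<close>, subst card_insert_disjoint)
      (auto simp: finite_affine_points card_image)
qed

text \<open>An arbitrary integer witness \<open>b\<close> may be reduced modulo \<open>p\<close> to
  a ring element with the same square.\<close>

lemma mem_quadratic_residues_iff:
  assumes "prime p" "a \<in> carrier (residue_ring (int p)) - {\<zero>\<^bsub>residue_ring (int p)\<^esub>}"
  shows "a \<in> quadratic_residues p \<longleftrightarrow> (\<exists>b. [b\<^sup>2 = a] (mod p))"
proof -
  define K where "K = residue_ring (int p)"
  interpret residues_prime p K
    by unfold_locales (simp_all add: assms K_def)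
  have carr: "carrier K = {0..<int p}"
    by (auto simp: res_carrier_eq)
  have a: "a mod int p = a"
    using assms(2)[folded K_def] carr by auto
  have "a \<in> quadratic_residues p \<longleftrightarrow> (\<exists>b \<in> carrier K. a = b\<^sup>2 mod p)"
    using assms(2)[folded K_def] nat_pow_eq
    unfolding quadratic_residues_def K_def[symmetric] by auto
  also have "\<dots> \<longleftrightarrow> (\<exists>b. [b\<^sup>2 = a] (mod p))"
  proof
    assume "\<exists>b. [b\<^sup>2 = a] (mod p)"
    then obtain b where "a = b\<^sup>2 mod int p"
      using a by (metis cong_def)
    then have "a = (b mod p)\<^sup>2 mod p"
      by (simp add: mod_simps)
    moreover have "b mod p \<in> carrier K"
      using carr m_gt_one by simp
    ultimately show "\<exists>b \<in> carrier K. a = b\<^sup>2 mod p" by blast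
  qed (auto simp: cong_def)
  finally show ?thesis .
qed

section \<open>Square roots and cube roots modulo a prime\<close>

lemma exists_square_cong_cube_iff:
  fixes p a :: int
  assumes "prime p" "\<not> p dvd a"
  shows "(\<exists>y. [y\<^sup>2 = a ^ 3] (mod p)) \<longleftrightarrow> (\<exists>b. [b\<^sup>2 = a] (mod p))"
proof
  assume "\<exists>b. [b\<^sup>2 = a] (mod p)"
  then obtain b where "[b\<^sup>2 = a] (mod p)" by blast
  from cong_pow[OF this, of 3] have "[(b ^ 3)\<^sup>2 = a ^ 3] (mod p)"
    by (simp add: power_mult[symmetric])
  then show "\<exists>y. [y\<^sup>2 = a ^ 3] (mod p)" by blast
next
  assume "\<exists>y. [y\<^sup>2 = a ^ 3] (mod p)"
  then obtain y where y: "[y\<^sup>2 = a ^ 3] (mod p)" by blast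
  \<comment> \<open>The square root of \<open>a\<close> is \<open>y / a\<close>, written
    \<open>y * c\<close> with \<open>c\<close> inverse to \<open>a\<close>; cancelling
    \<open>a\<^sup>2\<close> from \<open>y\<^sup>2 = a ^ 3\<close> confirms it.\<close>
  have "coprime a p"
    using assms by (metis coprime_commute prime_imp_coprime)
  then obtain c where "[a * c = 1] (mod p)"
    using cong_solve_coprime_int by blast
  from cong_mult[OF cong_refl[of y] this] have "[y * c * a = y] (mod p)"
    by (simp add: ac_simps)
  from cong_trans[OF cong_pow[OF this, of 2] y] have "[(y * c)\<^sup>2 * a\<^sup>2 = a * a\<^sup>2] (mod p)"
    by (simp add: power2_eq_square power3_eq_cube ac_simps)
  then have "[(y * c)\<^sup>2 = a] (mod p)"
    using assms by (simp add: cong_mult_rcancel_prime prime_dvd_power_iff)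
  then show "\<exists>b. [b\<^sup>2 = a] (mod p)" by blast
qed

text \<open>A root \<open>b\<close> yields exactly the residues of \<open>b\<close> and
  \<open>- b\<close>, which differ because \<open>p\<close> divides neither 2 nor
  \<open>b\<close>.\<close>

lemma card_sqrts_mod_prime:
  fixes p c :: int
  assumes "prime p" "odd p" "\<not> p dvd c"
  shows "card {y \<in> {0..<p}. [y\<^sup>2 = c] (mod p)} = (if \<exists>y. [y\<^sup>2 = c] (mod p) then 2 else 0)"
proof (cases "\<exists>y. [y\<^sup>2 = c] (mod p)")
  case True
  then obtain b where b: "[b\<^sup>2 = c] (mod p)" by blast
  have p: "p > 0" using assms(1) by (rule prime_gt_0_int)
  have "\<not> p dvd b"
    using b assms(3) by (metis cong_dvd_iff dvd_power_le dvd_refl dvd_trans dvd_triv_left power2_eq_square)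
  moreover have "\<not> p dvd 2"
    using assms(1,2) by (metis prime_int_numeral_eq primes_dvd_imp_eq two_is_prime_nat dvd_refl)
  ultimately have "\<not> p dvd b - - b"
    using assms(1) by (simp add: prime_dvd_mult_iff flip: mult_2)
  then have ne: "b mod p \<noteq> - b mod p"
    by (simp add: mod_eq_dvd_iff)
  have "[y\<^sup>2 = c] (mod p) \<longleftrightarrow> y = b mod p \<or> y = - b mod p" if "y \<in> {0..<p}" for y
    using cong_square_iff_prime[OF assms(1), of y b] b that
    by (metis cong_def cong_sym cong_trans atLeastLessThan_iff mod_pos_pos_trivial)
  then have "{y \<in> {0..<p}. [y\<^sup>2 = c] (mod p)} = {b mod p, - b mod p}"
    using p by auto
  with ne True show ?thesis by simp
qed auto

text \<open>The roots are \<open>a\<close>, \<open>a * w\<close> and \<open>a * w\<^sup>2\<close>.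
  They are distinct because \<open>p\<close> divides none of \<open>a\<close>, \<open>w\<close>,
  \<open>w - 1\<close> and \<open>w + 1\<close>.\<close>

lemma card_cube_roots_mod_prime:
  fixes p w a :: int
  assumes "prime p" "\<not> p dvd a" "\<not> [w = 1] (mod p)" "[w\<^sup>2 + w + 1 = 0] (mod p)"
  shows "card {x \<in> {0..<p}. [x ^ 3 = a ^ 3] (mod p)} = 3"
proof -
  have p: "p > 0" using assms(1) by (rule prime_gt_0_int)
  have s: "p dvd w\<^sup>2 + w + 1"
    using assms(4) by (simp add: cong_0_iff)
  have w1: "\<not> p dvd w - 1"
    using assms(3) by (simp add: cong_iff_dvd_diff)
  have w0: "\<not> p dvd w"
  proof
    assume "p dvd w"
    then have "p dvd (w\<^sup>2 + w + 1) - (w + 1) * w"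
      using s by (intro dvd_diff) auto
    then have "p dvd 1" by (simp add: power2_eq_square algebra_simps)
    then show False using assms(1) not_prime_unit by blast
  qed
  have "[x ^ 3 = a ^ 3] (mod p) \<longleftrightarrow> p dvd x - a \<or> p dvd x - a * w \<or> p dvd x - a * w\<^sup>2" for x
  proof -
    \<comment> \<open>The second summand vanishes modulo \<open>p\<close>; it collects the errors
      from replacing \<open>w\<^sup>2 + w\<close> by -1 and \<open>w ^ 3\<close> by 1.\<close>
    have "x ^ 3 - a ^ 3 = (x - a) * ((x - a * w) * (x - a * w\<^sup>2))
       + (w\<^sup>2 + w + 1) * ((x - a) * (a * x - a\<^sup>2 * (w - 1)))"
      by (simp add: power2_eq_square power3_eq_cube algebra_simps)
    then have "p dvd x ^ 3 - a ^ 3 \<longleftrightarrow> p dvd (x - a) * ((x - a * w) * (x - a * w\<^sup>2))"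
      using s by (simp add: dvd_add_left_iff)
    then show ?thesis
      using assms(1) by (simp add: cong_iff_dvd_diff prime_dvd_mult_iff)
  qed
  then have "[x ^ 3 = a ^ 3] (mod p) \<longleftrightarrow> x \<in> {a mod p, a * w mod p, a * w\<^sup>2 mod p}"
    if "x \<in> {0..<p}" for x
    using that by (simp flip: mod_eq_dvd_iff)
  then have "{x \<in> {0..<p}. [x ^ 3 = a ^ 3] (mod p)} = {a mod p, a * w mod p, a * w\<^sup>2 mod p}"
    using p by auto
  moreover have "a mod p \<noteq> a * w mod p"
  proof -
    have "a * w - a = a * (w - 1)" by (simp add: algebra_simps)
    then show ?thesis
      using w1 assms(1,2) by (metis mod_eq_dvd_iff prime_dvd_mult_iff)
  qed
  moreover have "a * w mod p \<noteq> a * w\<^sup>2 mod p"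
  proof -
    have "a * w\<^sup>2 - a * w = a * (w * (w - 1))"
      by (simp add: power2_eq_square algebra_simps)
    then show ?thesis
      using w1 w0 assms(1,2) by (metis mod_eq_dvd_iff prime_dvd_mult_iff)
  qed
  moreover have "a mod p \<noteq> a * w\<^sup>2 mod p"
  proof
    assume "a mod p = a * w\<^sup>2 mod p"
    then have "p dvd a * ((w - 1) * (w + 1))"
      by (metis (no_types, opaque_lifting) mod_eq_dvd_iff mult.right_neutral
          right_diff_distrib power2_eq_square square_diff_one_factored mult.commute)
    then have "p dvd w + 1"
      using w1 assms(1,2) by (simp add: prime_dvd_mult_iff)
    \<comment> \<open>The difference is \<open>w\<^sup>2\<close>, so \<open>p\<close> would divide
      \<open>w\<close>.\<close>
    with s have "p dvd (w\<^sup>2 + w + 1) - (w + 1)" by (rule dvd_diff)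
    then show False
      using w0 assms(1) by (simp add: prime_dvd_power_iff)
  qed
  ultimately show ?thesis by simp
qed

section \<open>Fixed points of the two symmetries of the curve\<close>

lemma card_affine_points_cong_mod_2:
  assumes "prime p" "odd p"
  shows "[card (affine_points p c) = card {x \<in> {0..<p}. [x ^ 3 = - c] (mod p)}] (mod 2)"
proof -
  have p: "p > 0" using assms(1) by (rule prime_gt_0_int)
  define f :: "int \<times> int \<Rightarrow> int \<times> int" where "f = (\<lambda>(x, y). (x, - y mod p))"
  \<comment> \<open>A nonzero fixed \<open>y\<close> would satisfy \<open>p = 2 * y\<close>, which
    is impossible for odd \<open>p\<close>.\<close>
  have fix_iff: "- y mod p = y \<longleftrightarrow> y = 0" if "y \<in> {0..<p}" for y
  proof (cases "y = 0")
    case False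
    then have "- y mod p = p - y"
      using that zmod_zminus1_eq_if[of y p] by auto
    then show ?thesis
      using assms(2) False by auto
  qed simp
  have "[card (affine_points p c) = card {z \<in> affine_points p c. f z = z}] (mod 2)"
  proof (rule card_cong_card_fixpoints)
    show "f ` affine_points p c \<subseteq> affine_points p c"
      using p by (auto simp: f_def affine_points_def cong_def mod_simps)
    show "(f ^^ 2) z = z" if "z \<in> affine_points p c" for z
      using that p by (auto simp: f_def affine_points_def numeral_2_eq_2 mod_simps)
  qed (simp_all add: finite_affine_points)
  also have "{z \<in> affine_points p c. f z = z} =
      (\<lambda>x. (x, 0)) ` {x \<in> {0..<p}. [x ^ 3 = - c] (mod p)}"
  proof -
    have "[0\<^sup>2 = x ^ 3 + c] (mod p) \<longleftrightarrow> [x ^ 3 = - c] (mod p)" for x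
      using dvd_minus_iff[of p "x ^ 3 + c"] by (simp add: cong_iff_dvd_diff algebra_simps)
    then show ?thesis
      using p fix_iff by (auto simp: f_def affine_points_def)
  qed
  also have "card \<dots> = card {x \<in> {0..<p}. [x ^ 3 = - c] (mod p)}"
    by (rule card_image) (auto simp: inj_on_def)
  finally show ?thesis .
qed

lemma card_affine_points_cong_mod_3:
  assumes "prime p" "[w ^ 3 = 1] (mod p)" "\<not> [w = 1] (mod p)"
  shows "[card (affine_points p c) = card {y \<in> {0..<p}. [y\<^sup>2 = c] (mod p)}] (mod 3)"
proof -
  have p: "p > 0" using assms(1) by (rule prime_gt_0_int)
  define f :: "int \<times> int \<Rightarrow> int \<times> int" where "f = (\<lambda>(x, y). (w * x mod p, y))"
  have fix_iff: "w * x mod p = x \<longleftrightarrow> x = 0" if "x \<in> {0..<p}" for x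
  proof -
    have "w * x - x = (w - 1) * x" by (simp add: algebra_simps)
    moreover have "w * x mod p = x \<longleftrightarrow> w * x mod p = x mod p"
      using that by simp
    ultimately have "w * x mod p = x \<longleftrightarrow> p dvd x"
      using assms(1,3) by (simp add: mod_eq_dvd_iff cong_iff_dvd_diff prime_dvd_mult_iff)
    then show ?thesis
      using that by (auto dest: zdvd_imp_le)
  qed
  \<comment> \<open>The first congruence keeps the image on the curve; the second is the shape in
    which three applications of \<open>f\<close> unfold.\<close>
  have w3: "[(w * x) ^ 3 = x ^ 3] (mod p)" "[w * (w * (w * x)) = x] (mod p)" for x
    using cong_mult[OF assms(2) cong_refl, of "x ^ 3"] cong_mult[OF assms(2) cong_refl, of x]
    by (simp_all add: power_mult_distrib power3_eq_cube ac_simps)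
  have "[card (affine_points p c) = card {z \<in> affine_points p c. f z = z}] (mod 3)"
  proof (rule card_cong_card_fixpoints)
    show "f ` affine_points p c \<subseteq> affine_points p c"
    proof (rule image_subsetI, unfold split_paired_all)
      fix x y assume xy: "(x, y) \<in> affine_points p c"
      have "[(w * x mod p) ^ 3 + c = x ^ 3 + c] (mod p)"
        using w3(1)[of x] by (intro cong_add) (simp_all add: cong_def mod_simps)
      then show "f (x, y) \<in> affine_points p c"
        using xy p
        by (auto simp: f_def affine_points_def intro: cong_trans[OF _ cong_sym])
    qed
    show "(f ^^ 3) z = z" if "z \<in> affine_points p c" for z
      using that p w3(2)
      by (auto simp: f_def affine_points_def numeral_3_eq_3 mod_simps cong_def)
  qed (simp_all add: finite_affine_points)
  also have "{z \<in> affine_points p c. f z = z} = Pair 0 ` {y \<in> {0..<p}. [y\<^sup>2 = c] (mod p)}"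
    using p fix_iff by (auto simp: f_def affine_points_def)
  also have "card \<dots> = card {y \<in> {0..<p}. [y\<^sup>2 = c] (mod p)}"
    by (rule card_image) (auto simp: inj_on_def)
  finally show ?thesis .
qed

theorem theorem13:
  fixes p :: nat and a :: int
  assumes "prime p" and "[p = 1] (mod 6)"
    and "a \<in> carrier (residue_ring (int p)) - {\<zero>\<^bsub>residue_ring (int p)\<^esub>}"
  shows "a \<in> quadratic_residues p \<longleftrightarrow> [num_points_cubed p a = 0] (mod 6)"
proof -
  have p: "prime (int p)" using assms(1) by simp
  have "[p = 1] (mod 2)" "[p = 1] (mod 3)"
    using assms(2) by (auto intro: cong_dvd_modulus_nat)
  then have odd: "odd (int p)" and p3: "[p = 1] (mod 3)"
    by (auto simp: cong_def odd_iff_mod_2_eq_one)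
  obtain w :: int where w: "[w ^ 3 = 1] (mod p)" "\<not> [w = 1] (mod p)"
      "[w\<^sup>2 + w + 1 = 0] (mod p)"
    using primitive_cube_root_of_unity[OF assms(1) p3] .
  have "0 < a" "a < int p"
    using assms(3) by (auto simp: residue_ring_def)
  then have a: "\<not> int p dvd a"
    by (simp add: zdvd_not_zless)
  let ?n = "card (affine_points p (a ^ 3))"
  \<comment> \<open>Fixed points satisfy \<open>x ^ 3 = - (a ^ 3) = (- a) ^ 3\<close> modulo
    \<open>p\<close>, hence the cube root count is taken at \<open>- a\<close>.\<close>
  have "[?n = 3] (mod 2)"
    using card_affine_points_cong_mod_2[OF p odd, of "a ^ 3"]
      card_cube_roots_mod_prime[OF p _ w(2,3), of "- a"] a by simp
  then have even: "2 dvd Suc ?n"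
    by (simp add: cong_def odd_iff_mod_2_eq_one)
  have "\<not> int p dvd a ^ 3"
    using a p by (simp add: prime_dvd_power_iff)
  then have "[?n = (if a \<in> quadratic_residues p then 2 else 0)] (mod 3)"
    using card_affine_points_cong_mod_3[OF p w(1,2), of "a ^ 3"]
      card_sqrts_mod_prime[OF p odd, of "a ^ 3"]
      exists_square_cong_cube_iff[OF p a] mem_quadratic_residues_iff[OF assms(1,3)]
    by simp
  \<comment> \<open>Adding the point at infinity turns the residues 2 and 0 modulo 3 into 0 and
    1.\<close>
  then have "a \<in> quadratic_residues p \<longleftrightarrow> 3 dvd Suc ?n"
    unfolding cong_def by (cases "a \<in> quadratic_residues p") (simp_all, presburger+)
  also have "\<dots> \<longleftrightarrow> 6 dvd Suc ?n"
    using even by presburger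
  finally show ?thesis
    using num_points_cubed_eq[OF assms(1), of a] assms(3) by (simp add: cong_0_iff)
qed

end
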